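(* (1) Every HY-system is disjoint from every minimal system. (2) Every transitive system with dense small periodic sets is disjoint from every totally minimal system.
   Context: A system (topological dynamical system) is a pair $(X,T)$ with $X$ a nonempty compact metric space and $T:X\to X$ continuous. "Opene" means nonempty open. $(X,T)$ is transitive if for all opene $U,V\subset X$ the set $\{n\in\mathbb Z_+: U\cap T^{-n}V\neq\emptyset\}$ is infinite; it is totally transitive if $(X,T^k)$ is transitive for every $k\in\mathbb N$ (positive integers). $(X,T)$ has dense small periodic sets if for every opene $U\subset X$ there are a nonempty closed set $Z\subset U$ and $k\in\mathbb N$ with $T^kZ\subset Z$. An HY-system is a system that is totally transitive and has dense small periodic sets. A system $(X,T)$ is minimal if it has no proper nonempty closed subset $Z\subset X$ with $TZ\subset Z$; it is totally minimal if $(X,T^k)$ is minimal for every $k\in\mathbb N$. A joining of systems $(X,T)$ and $(Y,S)$ is a nonempty closed set $J\subset X\times Y$ with $(T\times S)J\subset J$ that projects onto both $X$ and $Y$; the two systems are disjoint if the only joining is $X\times Y$. *)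

theory Defs
  imports "HOL-Analysis.Analysis"
begin

(* A system is a pair (X, T) of a carrier set X in an ambient metric space and a map T that is
   only relevant on X.  "Open" and "closed" always mean relative to the phase space X. *)

definition tds :: "'a::metric_space set \<Rightarrow> ('a \<Rightarrow> 'a) \<Rightarrow> bool" where
  "tds X T \<longleftrightarrow> X \<noteq> {} \<and> compact X \<and> T ` X \<subseteq> X \<and> continuous_on X T"

definition opene :: "'a::metric_space set \<Rightarrow> 'a set \<Rightarrow> bool" where
  "opene X U \<longleftrightarrow> openin (top_of_set X) U \<and> U \<noteq> {}"

(* U is contained in X, so intersecting with the preimage under the total function T ^^ n is the
   same as intersecting with the preimage taken in X. *)
definition tds_transitive :: "'a::metric_space set \<Rightarrow> ('a \<Rightarrow> 'a) \<Rightarrow> bool" where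
  "tds_transitive X T \<longleftrightarrow>
     (\<forall>U V. opene X U \<and> opene X V \<longrightarrow> infinite {n::nat. U \<inter> (T ^^ n) -` V \<noteq> {}})"

definition totally_transitive :: "'a::metric_space set \<Rightarrow> ('a \<Rightarrow> 'a) \<Rightarrow> bool" where
  "totally_transitive X T \<longleftrightarrow> (\<forall>k\<ge>1. tds_transitive X (T ^^ k))"

definition dense_small_periodic_sets :: "'a::metric_space set \<Rightarrow> ('a \<Rightarrow> 'a) \<Rightarrow> bool" where
  "dense_small_periodic_sets X T \<longleftrightarrow>
     (\<forall>U. opene X U \<longrightarrow>
        (\<exists>Z k. closedin (top_of_set X) Z \<and> Z \<noteq> {} \<and> Z \<subseteq> U \<and> k \<ge> 1 \<and> (T ^^ k) ` Z \<subseteq> Z))"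

definition HY_system :: "'a::metric_space set \<Rightarrow> ('a \<Rightarrow> 'a) \<Rightarrow> bool" where
  "HY_system X T \<longleftrightarrow> tds X T \<and> totally_transitive X T \<and> dense_small_periodic_sets X T"

definition tds_minimal :: "'a::metric_space set \<Rightarrow> ('a \<Rightarrow> 'a) \<Rightarrow> bool" where
  "tds_minimal X T \<longleftrightarrow>
     \<not> (\<exists>Z. closedin (top_of_set X) Z \<and> Z \<noteq> {} \<and> Z \<noteq> X \<and> T ` Z \<subseteq> Z)"

definition totally_minimal :: "'a::metric_space set \<Rightarrow> ('a \<Rightarrow> 'a) \<Rightarrow> bool" where
  "totally_minimal X T \<longleftrightarrow> (\<forall>k\<ge>1. tds_minimal X (T ^^ k))"

definition joining ::
  "'a::metric_space set \<Rightarrow> ('a \<Rightarrow> 'a) \<Rightarrow> 'b::metric_space set \<Rightarrow> ('b \<Rightarrow> 'b) \<Rightarrow> ('a \<times> 'b) set \<Rightarrow> bool"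
where
  "joining X T Y S J \<longleftrightarrow>
     J \<noteq> {} \<and> closedin (top_of_set (X \<times> Y)) J \<and> map_prod T S ` J \<subseteq> J \<and> fst ` J = X \<and> snd ` J = Y"

definition disjoint_systems ::
  "'a::metric_space set \<Rightarrow> ('a \<Rightarrow> 'a) \<Rightarrow> 'b::metric_space set \<Rightarrow> ('b \<Rightarrow> 'b) \<Rightarrow> bool" where
  "disjoint_systems X T Y S \<longleftrightarrow> {J. joining X T Y S J} = {X \<times> Y}"

end

theory Submission
  imports Defs
begin

text \<open>
  Let \<open>J\<close> be a joining, \<open>U \<subseteq> X\<close> nonempty open and \<open>Z \<subseteq> U\<close> closed with \<open>T\<^sup>k Z \<subseteq> Z\<close>. The set \<open>J `` Z\<close>
  of points of \<open>Y\<close> joined to \<open>Z\<close> is nonempty, closed and \<open>S\<^sup>k\<close>-invariant. If it is all of \<open>Y\<close> for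
  every such \<open>U\<close>, then every fibre of \<open>J\<close> over a point of \<open>Y\<close> is dense in \<open>X\<close>, so \<open>J = X \<times> Y\<close>. Total
  minimality gives \<open>J `` Z = Y\<close> at once. If \<open>(Y, S)\<close> is only minimal, take an \<open>S\<^sup>k\<close>-minimal set \<open>M\<close>;
  the \<open>S\<^sup>k\<close>-minimal sets \<open>S\<^sup>i M\<close> with \<open>i < k\<close> cover \<open>Y\<close>, so the sets of points of \<open>X\<close> joined to them
  are \<open>T\<^sup>k\<close>-invariant and cover \<open>X\<close>. Since \<open>T\<^sup>k\<close> is transitive one of these is \<open>X\<close>, hence by
  surjectivity of \<open>T\<close> all of them are. Therefore every \<open>S\<^sup>i M\<close> meets \<open>J `` Z\<close>, and by minimality lies
  in it.
\<close>

section \<open>Minimal sets of a map and of its iterates\<close>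

lemma tds_minimalI:
  assumes "compact X" "\<And>Z. \<lbrakk>compact Z; Z \<noteq> {}; Z \<subseteq> X; T ` Z \<subseteq> Z\<rbrakk> \<Longrightarrow> Z = X"
  shows "tds_minimal X T"
  unfolding tds_minimal_def closedin_compact_eq[OF assms(1)] using assms(2) by blast

lemma tds_minimalD:
  assumes "tds_minimal X T" "compact Z" "Z \<noteq> {}" "Z \<subseteq> X" "T ` Z \<subseteq> Z"
  shows "Z = X"
  using assms closed_subset[OF assms(4) compact_imp_closed[OF assms(2)]]
  unfolding tds_minimal_def by blast

lemma funpow_image_subset: "T ` X \<subseteq> X \<Longrightarrow> (T ^^ n) ` X \<subseteq> X"
  by (induction n) auto

lemma funpow_continuous_on:
  assumes "continuous_on X T" "T ` X \<subseteq> X"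
  shows "continuous_on X (T ^^ n)"
proof (induction n)
  case (Suc n)
  have "continuous_on ((T ^^ n) ` X) T"
    by (rule continuous_on_subset[OF assms(1) funpow_image_subset[OF assms(2)]])
  with Suc show ?case
    unfolding funpow.simps by (rule continuous_on_compose)
qed (simp add: id_def)

lemma tds_funpow: "tds X T \<Longrightarrow> tds X (T ^^ n)"
  by (simp add: tds_def funpow_image_subset funpow_continuous_on)

lemma map_prod_funpow:
  fixes T :: "'a \<Rightarrow> 'a" and S :: "'b \<Rightarrow> 'b"
  shows "map_prod T S ^^ n = map_prod (T ^^ n) (S ^^ n)"
  by (induction n) (auto simp: fun_eq_iff)

text \<open>Zorn's lemma on the nonempty compact invariant subsets, ordered by reverse inclusion: a
  maximal element is a minimal set, and compactness keeps the intersection of a chain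
  nonempty.\<close>

lemma ex_minimal_subsystem:
  assumes "tds Y R"
  obtains M where "M \<subseteq> Y" "tds M R" "tds_minimal M R"
proof -
  define F where "F = {Z. compact Z \<and> Z \<noteq> {} \<and> Z \<subseteq> Y \<and> R ` Z \<subseteq> Z}"
  have Y: "Y \<in> F"
    using assms by (auto simp: F_def tds_def)
  have "\<exists>M\<in>F. \<forall>Z\<in>F. Z \<subseteq> M \<longrightarrow> Z = M"
  proof (rule predicate_Zorn)
    show "partial_order_on F (relation_of (\<lambda>A B. B \<subseteq> A) F)"
      by (rule partial_order_on_relation_ofI) auto
    fix C assume "C \<in> Chains (relation_of (\<lambda>A B. B \<subseteq> A) F)"
    then have C: "C \<subseteq> F" "\<And>A B. A \<in> C \<Longrightarrow> B \<in> C \<Longrightarrow> A \<subseteq> B \<or> B \<subseteq> A"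
      by (auto simp: Chains_def relation_of_def)
    show "\<exists>U\<in>F. \<forall>Z\<in>C. U \<subseteq> Z"
    proof (cases "C = {}")
      case True
      then show ?thesis using Y by blast
    next
      case False
      have closed: "closed Z" and inv: "R ` Z \<subseteq> Z" if "Z \<in> C" for Z
        using that C(1) by (auto simp: F_def intro: compact_imp_closed)
      have "Y \<inter> \<Inter>C \<noteq> {}"
      proof (rule compact_imp_fip)
        show "compact Y"
          using assms by (simp add: tds_def)
        show "closed Z" if "Z \<in> C" for Z
          using that by (rule closed)
        show "Y \<inter> \<Inter>D \<noteq> {}" if D: "finite D" "D \<subseteq> C" for D
        proof (cases "D = {}")
          case True
          then show ?thesis using Y by (simp add: F_def)
        next
          case False
          \<comment> \<open>A nonempty finite part of a chain has a least member, which is its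
            intersection; this gives the finite intersection property.\<close>
          have "subset.chain C D"
            using C(2) D(2) by (auto simp: subset_chain_def)
          then have "\<Inter>D \<in> D"
            using D(1) False by (rule Inter_in_chain[rotated 2])
          then have "\<Inter>D \<in> F"
            using C(1) D(2) by blast
          then show ?thesis
            by (auto simp: F_def)
        qed
      qed
      then have "\<Inter>C \<noteq> {}"
        by blast
      moreover from False obtain Z where Z: "Z \<in> C"
        by blast
      moreover have "closed (\<Inter>C)"
        using closed by (rule closed_Inter[rule_format])
      \<comment> \<open>The intersection is a closed subset of any one compact member
        \<open>Z\<close>.\<close>
      then have "compact (Z \<inter> \<Inter>C)"
        using Z C(1) by (intro compact_Int_closed) (auto simp: F_def)
      then have "compact (\<Inter>C)"
        using Z by (simp add: Inf_lower inf.absorb2)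
      moreover have "\<Inter>C \<subseteq> Y"
        using Z C(1) by (auto simp: F_def)
      moreover have "R ` \<Inter>C \<subseteq> \<Inter>C"
        using inv by blast
      ultimately have "\<Inter>C \<in> F"
        by (simp add: F_def)
      then show ?thesis
        by (rule bexI[rotated]) (simp add: Inf_lower)
    qed
  qed
  then obtain M where M: "M \<in> F" "\<And>Z. Z \<in> F \<Longrightarrow> Z \<subseteq> M \<Longrightarrow> Z = M"
    by blast
  show thesis
  proof
    show "M \<subseteq> Y" "tds M R"
      using M(1) assms by (auto simp: F_def tds_def intro: continuous_on_subset)
    show "tds_minimal M R"
    proof (rule tds_minimalI)
      show "compact M"
        using M(1) by (simp add: F_def)
      fix Z assume "compact Z" "Z \<noteq> {}" "Z \<subseteq> M" "R ` Z \<subseteq> Z"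
      with M(1) show "Z = M"
        by (intro M(2)) (auto simp: F_def)
    qed
  qed
qed

text \<open>A subsystem of the image pulls back to a nonempty compact \<open>R\<close>-invariant
  subset of \<open>M\<close>, which must be \<open>M\<close>. The later use is
  \<open>f = S ^^ i\<close>, \<open>R = S ^^ k\<close>.\<close>

lemma tds_minimal_image:
  assumes "tds M R" "tds_minimal M R" "continuous_on M f" "\<And>x. x \<in> M \<Longrightarrow> f (R x) = R (f x)"
  shows "tds_minimal (f ` M) R"
proof -
  have M: "compact M" "R ` M \<subseteq> M"
    using assms(1) by (auto simp: tds_def)
  have sub: "f ` M \<subseteq> N" if N: "compact N" "N \<noteq> {}" "N \<subseteq> f ` M" "R ` N \<subseteq> N" for N
  proof -
    define L where "L = M \<inter> f -` N"
    have "closedin (top_of_set M) L"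
      unfolding L_def using assms(3) N(1) compact_imp_closed continuous_closedin_preimage by blast
    then have "compact L"
      using M(1) closedin_compact by blast
    moreover have "L \<noteq> {}" "L \<subseteq> M"
      using N(2,3) unfolding L_def by blast+
    moreover have "R ` L \<subseteq> L"
      using N(4) M(2) assms(4) by (auto simp: L_def)
    ultimately have "L = M"
      by (rule tds_minimalD[OF assms(2)])
    then show ?thesis
      by (auto simp: L_def)
  qed
  show ?thesis
  proof (rule tds_minimalI)
    show "compact (f ` M)"
      by (rule compact_continuous_image[OF assms(3) M(1)])
  qed (use sub in blast)
qed

text \<open>\<open>S\<close> moves each piece of the union to the next and, by the hypothesis on
  \<open>S ^^ k\<close>, the last one back into \<open>M\<close>. So the union is a subsystem of a
  minimal system.\<close>

lemma minimal_eq_UN_funpow: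
  assumes "tds Y S" "tds_minimal Y S" "k \<ge> 1"
    and "M \<subseteq> Y" "compact M" "M \<noteq> {}" "(S ^^ k) ` M \<subseteq> M"
  shows "(\<Union>i<k. (S ^^ i) ` M) = Y"
proof -
  let ?N = "\<Union>i<k. (S ^^ i) ` M"
  have Y: "compact Y" "S ` Y \<subseteq> Y" "continuous_on Y S"
    using assms(1) by (auto simp: tds_def)
  have "compact ((S ^^ i) ` M)" for i
    using funpow_continuous_on[OF Y(3,2)] assms(4,5)
    by (meson compact_continuous_image continuous_on_subset)
  then have "compact ?N"
    by (intro compact_UN) auto
  moreover have "?N \<noteq> {}"
    using assms(3,6) by (auto intro: exI[of _ 0])
  moreover have "?N \<subseteq> Y"
    using funpow_image_subset[OF Y(2)] assms(4) by blast
  moreover have "S ` ?N \<subseteq> ?N"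
  proof clarify
    fix i x assume i: "i < k" and x: "x \<in> M"
    show "S ((S ^^ i) x) \<in> ?N"
    proof (cases "Suc i = k")
      \<comment> \<open>The wrap-around: \<open>S ^^ k\<close> returns to \<open>M\<close>, the
        piece with index 0.\<close>
      case True
      then have "S ((S ^^ i) x) \<in> (S ^^ 0) ` M"
        using assms(7) x by auto
      moreover have "0 \<in> {..<k}"
        using assms(3) by simp
      ultimately show ?thesis by (rule UN_I[rotated])
    next
      case False
      then have "Suc i \<in> {..<k}"
        using i by simp
      moreover have "S ((S ^^ i) x) \<in> (S ^^ Suc i) ` M"
        using x by simp
      ultimately show ?thesis by (rule UN_I)
    qed
  qed
  ultimately show ?thesis
    by (rule tds_minimalD[OF assms(2)])
qed

section \<open>Consequences of transitivity\<close>

lemma transitive_surj: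
  assumes "tds X T" "tds_transitive X T"
  shows "T ` X = X"
proof (rule ccontr)
  assume ne: "T ` X \<noteq> X"
  have X: "compact X" "T ` X \<subseteq> X" "continuous_on X T" "X \<noteq> {}"
    using assms(1) by (auto simp: tds_def)
  have "closedin (top_of_set X) (T ` X)"
    by (intro closed_subset compact_imp_closed compact_continuous_image X)
  then have "opene X (X - T ` X)"
    using X(2) ne unfolding opene_def by (blast intro: openin_diff openin_subtopology_self)
  moreover have "opene X X"
    using X by (simp add: opene_def)
  ultimately have "infinite {n. X \<inter> (T ^^ n) -` (X - T ` X) \<noteq> {}}"
    using assms(2) unfolding tds_transitive_def by blast
  \<comment> \<open>No orbit is in \<open>X - T X\<close> at a positive time. Time 0 gives no
    contradiction, so infinitude of the set of times is used to get \<open>n > 0\<close>.\<close>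
  then obtain n where n: "n > 0" "n \<in> {n. X \<inter> (T ^^ n) -` (X - T ` X) \<noteq> {}}"
    by (rule infinite_nat_iff_unbounded[THEN iffD1, THEN spec, THEN exE]) (elim conjE)
  then obtain m where m: "n = Suc m"
    using gr0_implies_Suc by blast
  from n(2) obtain x where "x \<in> X" "(T ^^ Suc m) x \<notin> T ` X"
    unfolding m by blast
  then show False
    using funpow_image_subset[OF X(2), of m] by auto
qed

text \<open>A point outside \<open>A\<close> lies in \<open>B\<close> and stays there, so the open
  set \<open>X - A\<close> never reaches the open set \<open>X - B\<close>; one of the two must be
  empty.\<close>

lemma transitive_invariant_Un:
  assumes "tds_transitive X T" "closedin (top_of_set X) A" "closedin (top_of_set X) B"
    and "T ` B \<subseteq> B" "A \<union> B = X"
  shows "A = X \<or> B = X"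
proof (rule ccontr)
  assume "\<not> ?thesis"
  then have "opene X (X - A)" "opene X (X - B)"
    using assms(2,3,5) unfolding opene_def by (blast intro: openin_diff openin_subtopology_self)+
  then have "infinite {n. (X - A) \<inter> (T ^^ n) -` (X - B) \<noteq> {}}"
    using assms(1) unfolding tds_transitive_def by blast
  then obtain n x where "x \<in> X - A" "(T ^^ n) x \<notin> B"
    using not_finite_existsD by blast
  then show False
    using funpow_image_subset[OF assms(4), of n] assms(5) by auto
qed

text \<open>Induction on the number of sets: split off one and let the union of the others, closed
  by finiteness and invariant, be the set \<open>B\<close> of the two-set case.\<close>

lemma transitive_invariant_UN:
  assumes "tds_transitive X T" "X \<noteq> {}" "finite I"
    and "\<And>i. i \<in> I \<Longrightarrow> closedin (top_of_set X) (A i)" "\<And>i. i \<in> I \<Longrightarrow> T ` A i \<subseteq> A i"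
    and "(\<Union>i\<in>I. A i) = X"
  shows "\<exists>i\<in>I. A i = X"
  using assms(3-6)
proof (induction I rule: finite_induct)
  case empty
  then show ?case using assms(2) by simp
next
  case (insert j I)
  let ?B = "\<Union>i\<in>I. A i"
  have closed: "closedin (top_of_set X) ?B"
    using insert.hyps(1) insert.prems(1) by (intro closedin_Union) auto
  have inv: "T ` ?B \<subseteq> ?B"
    using insert.prems(2) by blast
  have "A j \<union> ?B = X"
    using insert.prems(3) by simp
  then consider "A j = X" | "?B = X"
    using transitive_invariant_Un[OF assms(1) insert.prems(1)[OF insertI1] closed inv] by blast
  then show ?case
  proof cases
    case 1
    then show ?thesis by simp
  next
    case 2
    then have "\<exists>i\<in>I. A i = X"
      by (intro insert.IH insert.prems) simp_all
    then show ?thesis by simp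
  qed
qed

section \<open>Images under compact invariant relations\<close>

lemma compact_relation_Image:
  fixes J :: "('a::metric_space \<times> 'b::metric_space) set"
  assumes "compact J" "compact Z"
  shows "compact (J `` Z)"
proof -
  have "J `` Z = snd ` (J \<inter> Z \<times> UNIV)"
    by force
  moreover have "compact (J \<inter> Z \<times> UNIV)"
    using assms by (intro compact_Int_closed closed_Times) (auto intro: compact_imp_closed)
  ultimately show ?thesis
    by (simp add: compact_continuous_image continuous_on_snd)
qed

lemma compact_relation_converse:
  fixes J :: "('a::metric_space \<times> 'b::metric_space) set"
  assumes "compact J"
  shows "compact (J\<inverse>)"
proof -
  have "J\<inverse> = prod.swap ` J"
    by force
  then show ?thesis
    using assms by (simp add: compact_continuous_image continuous_on_swap)
qed

text \<open>The image of \<open>Z\<close> under \<open>J\<close> is compact and, by invariance of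
  \<open>J\<close> and \<open>Z\<close>, \<open>S\<close>-invariant. Its trace on \<open>M\<close>
  is thus a subsystem of \<open>M\<close>, nonempty by hypothesis.\<close>

lemma minimal_subset_Image:
  fixes J :: "('a::metric_space \<times> 'b::metric_space) set"
  assumes "tds M S" "tds_minimal M S" "compact J" "map_prod T S ` J \<subseteq> J"
    and "compact Z" "T ` Z \<subseteq> Z" "J `` Z \<inter> M \<noteq> {}"
  shows "M \<subseteq> J `` Z"
proof -
  have M: "compact M" "S ` M \<subseteq> M"
    using assms(1) by (auto simp: tds_def)
  have "S ` (J `` Z) \<subseteq> J `` Z"
  proof clarify
    fix z y assume "z \<in> Z" "(z, y) \<in> J"
    then have "T z \<in> Z" "(T z, S y) \<in> J"
      using assms(4,6) by force+
    then show "S y \<in> J `` Z" by blast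
  qed
  then have inv: "S ` (J `` Z \<inter> M) \<subseteq> J `` Z \<inter> M"
    using M(2) by blast
  have "compact (J `` Z \<inter> M)"
    by (intro compact_Int compact_relation_Image assms M)
  then have "J `` Z \<inter> M = M"
    using assms(7) inv by (intro tds_minimalD[OF assms(2)]) simp_all
  then show ?thesis by blast
qed

section \<open>Joinings and disjointness\<close>

lemma joining_compact:
  assumes "tds X T" "tds Y S" "joining X T Y S J"
  shows "compact J"
proof (rule closedin_compact)
  show "compact (X \<times> Y)"
    using assms(1,2) by (simp add: tds_def compact_Times)
  show "closedin (top_of_set (X \<times> Y)) J"
    using assms(3) by (simp add: joining_def)
qed

text \<open>\<open>disjoint_systems\<close> equates the set of joinings with a singleton, so the
  product has to be a joining itself; its projections are onto because both spaces are
  nonempty.\<close>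

lemma joining_Times:
  assumes "tds X T" "tds Y S"
  shows "joining X T Y S (X \<times> Y)"
  using assms unfolding joining_def tds_def by auto

lemma joining_eq_Times:
  assumes "tds X T" "tds Y S" "joining X T Y S J" "dense_small_periodic_sets X T"
    and full: "\<And>Z k. \<lbrakk>compact Z; Z \<noteq> {}; Z \<subseteq> X; k \<ge> 1; (T ^^ k) ` Z \<subseteq> Z\<rbrakk> \<Longrightarrow> Y \<subseteq> J `` Z"
  shows "J = X \<times> Y"
proof (rule ccontr)
  assume "J \<noteq> X \<times> Y"
  moreover have "J \<subseteq> X \<times> Y"
    using assms(3) by (auto simp: joining_def dest: closedin_imp_subset)
  ultimately obtain x y where xy: "x \<in> X" "y \<in> Y" "(x, y) \<notin> J"
    by auto
  \<comment> \<open>\<open>?U\<close> consists of the points not joined to \<open>y\<close>. A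
    periodic set inside it cannot have \<open>y\<close> in its image under \<open>J\<close>.\<close>
  let ?U = "X \<inter> (\<lambda>x. (x, y)) -` (- J)"
  have "openin (top_of_set X) ?U"
    using joining_compact[OF assms(1-3)]
    by (intro continuous_openin_preimage_gen continuous_intros) (simp add: compact_imp_closed open_Compl)
  then have "opene X ?U"
    using xy unfolding opene_def by blast
  from assms(4)[unfolded dense_small_periodic_sets_def, rule_format, OF this]
  obtain Z k where Z: "closedin (top_of_set X) Z" "Z \<noteq> {}" "Z \<subseteq> ?U" "k \<ge> 1" "(T ^^ k) ` Z \<subseteq> Z"
    by (elim exE conjE)
  then have "compact Z"
    using assms(1) closedin_compact by (auto simp: tds_def)
  then have "y \<in> J `` Z"
    using full[of Z k] Z xy(2) by blast
  then show False
    using Z(3) by blast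
qed

lemma joining_funpow_subset: "joining X T Y S J \<Longrightarrow> map_prod (T ^^ k) (S ^^ k) ` J \<subseteq> J"
  unfolding map_prod_funpow[symmetric] by (rule funpow_image_subset) (simp add: joining_def)

lemma joining_Image_eq_minimal:
  assumes "tds X T" "tds Y S" "joining X T Y S J" "totally_transitive X T" "tds_minimal Y S"
    and Z: "compact Z" "Z \<noteq> {}" "Z \<subseteq> X" "k \<ge> 1" "(T ^^ k) ` Z \<subseteq> Z"
  shows "Y \<subseteq> J `` Z"
proof -
  have J: "compact J" "map_prod T S ` J \<subseteq> J" "fst ` J = X" "snd ` J = Y"
    using assms(3) joining_compact[OF assms(1-3)] unfolding joining_def by blast+
  have J_Image: "J\<inverse> `` A \<subseteq> X" for A
    unfolding J(3)[symmetric] by force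
  have Jk: "map_prod (T ^^ k) (S ^^ k) ` J \<subseteq> J"
    using assms(3) by (rule joining_funpow_subset)
  have X: "X \<noteq> {}" and Y: "compact Y" "S ` Y \<subseteq> Y" "continuous_on Y S"
    using assms(1,2) by (auto simp: tds_def)
  have trans: "tds_transitive X T" "tds_transitive X (T ^^ k)"
    \<comment> \<open>The instance 1 yields transitivity of \<open>T\<close> itself, from which
      surjectivity of \<open>T\<close> follows below.\<close>
    using assms(4)[unfolded totally_transitive_def, rule_format, of 1]
      assms(4)[unfolded totally_transitive_def, rule_format, OF Z(4)] by simp_all
  obtain M where M: "M \<subseteq> Y" "tds M (S ^^ k)" "tds_minimal M (S ^^ k)"
    using ex_minimal_subsystem[OF tds_funpow[OF assms(2)]] .
  define N where "N i = (S ^^ i) ` M" for i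
  have N_sub: "N i \<subseteq> Y" for i
    unfolding N_def using funpow_image_subset[OF Y(2)] M(1) by blast
  have cont: "continuous_on M (S ^^ i)" for i
    using funpow_continuous_on[OF Y(3,2)] M(1) continuous_on_subset by blast
  have comm: "(S ^^ i) ((S ^^ k) x) = (S ^^ k) ((S ^^ i) x)" for i x
    by (metis add.commute comp_apply funpow_add)
  have N_inv: "(S ^^ k) ` N i \<subseteq> N i" for i
  proof -
    have "(S ^^ k) ` N i = (S ^^ i) ` (S ^^ k) ` M"
      unfolding N_def image_image comm ..
    also have "\<dots> \<subseteq> N i"
      unfolding N_def using M(2) by (intro image_mono) (simp add: tds_def)
    finally show ?thesis .
  qed
  have N_tds: "tds (N i) (S ^^ k)" for i
    using M(2) N_inv[of i] cont[of i] N_sub[of i] funpow_continuous_on[OF Y(3,2), of k]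
    unfolding tds_def N_def by (auto intro: compact_continuous_image continuous_on_subset)
  have N_min: "tds_minimal (N i) (S ^^ k)" for i
    unfolding N_def using tds_minimal_image[OF M(2,3) cont[of i]] comm by blast
  \<comment> \<open>Covering from any starting index \<open>i\<close> makes \<open>N i\<close>, ...,
    \<open>N (i + k - 1)\<close> cover \<open>Y\<close>, so indices never have to be reduced modulo
    \<open>k\<close>.\<close>
  have cover: "(\<Union>j<k. (S ^^ j) ` N i) = Y" for i
    using minimal_eq_UN_funpow[OF assms(2,5) Z(4) N_sub[of i]] N_tds[of i] by (simp add: tds_def)
  have "\<exists>i\<in>{..<k}. J\<inverse> `` N i = X"
  proof (rule transitive_invariant_UN[OF trans(2) X])
    show "closedin (top_of_set X) (J\<inverse> `` N i)" for i
    proof (rule closed_subset)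
      show "J\<inverse> `` N i \<subseteq> X"
        by (rule J_Image)
      show "closed (J\<inverse> `` N i)"
        using N_tds[of i]
        by (intro compact_imp_closed compact_relation_Image compact_relation_converse J(1))
          (simp add: tds_def)
    qed
    show "(T ^^ k) ` (J\<inverse> `` N i) \<subseteq> J\<inverse> `` N i" for i
    proof clarify
      fix x y assume "y \<in> N i" "(x, y) \<in> J"
      then have "(S ^^ k) y \<in> N i" "((T ^^ k) x, (S ^^ k) y) \<in> J"
        using N_inv[of i] Jk by auto
      then show "(T ^^ k) x \<in> J\<inverse> `` N i" by blast
    qed
    show "(\<Union>i<k. J\<inverse> `` N i) = X"
    proof -
      have "(\<Union>i<k. J\<inverse> `` N i) = J\<inverse> `` Y"
        using cover[of 0] by (auto simp: N_def)
      also have "\<dots> = X"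
        unfolding J(3,4)[symmetric] by force
      finally show ?thesis .
    qed
  qed simp
  then obtain i where i: "J\<inverse> `` N i = X"
    by blast
  \<comment> \<open>If every point of \<open>X\<close> is joined to \<open>N (i + j)\<close>, then
    every point of \<open>T X = X\<close> is joined to its image under \<open>S\<close>, which is
    \<open>N (i + Suc j)\<close>.\<close>
  have all: "J\<inverse> `` N (i + j) = X" for j
  proof (induction j)
    case (Suc j)
    have "T ` (J\<inverse> `` N (i + j)) \<subseteq> J\<inverse> `` N (i + Suc j)"
    proof clarify
      fix x y assume "y \<in> N (i + j)" "(x, y) \<in> J"
      then have "S y \<in> N (i + Suc j)" "(T x, S y) \<in> J"
        using J(2) by (auto simp: N_def)
      then show "T x \<in> J\<inverse> `` N (i + Suc j)" by blast
    qed
    then have "X \<subseteq> J\<inverse> `` N (i + Suc j)"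
      unfolding Suc transitive_surj[OF assms(1) trans(1)] .
    then show ?case
      using J_Image by blast
  qed (use i in simp)
  have sub: "N (i + j) \<subseteq> J `` Z" for j
  proof (rule minimal_subset_Image[OF N_tds N_min J(1) Jk Z(1,5)])
    show "J `` Z \<inter> N (i + j) \<noteq> {}"
      \<comment> \<open>Any point of \<open>Z\<close> is joined to some point of
        \<open>N (i + j)\<close>.\<close>
      using all[of j] Z(2,3) by blast
  qed
  have "(S ^^ j) ` N i = N (i + j)" for j
    unfolding N_def by (simp add: add.commute[of i] funpow_add image_comp)
  then show ?thesis
    using cover[of i] sub by blast
qed

theorem theorem5p4:
  fixes X :: "'a::metric_space set" and T :: "'a \<Rightarrow> 'a"
    and Y :: "'b::metric_space set" and S :: "'b \<Rightarrow> 'b"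
  assumes "tds X T" and "tds Y S"
  shows "(HY_system X T \<and> tds_minimal Y S \<longrightarrow> disjoint_systems X T Y S) \<and>
         (tds_transitive X T \<and> dense_small_periodic_sets X T \<and> totally_minimal Y S
            \<longrightarrow> disjoint_systems X T Y S)"
proof (intro conjI impI)
  assume "HY_system X T \<and> tds_minimal Y S"
  then have H: "totally_transitive X T" "dense_small_periodic_sets X T" "tds_minimal Y S"
    unfolding HY_system_def by blast+
  have "J = X \<times> Y" if J: "joining X T Y S J" for J
    by (rule joining_eq_Times[OF assms J H(2)]) (rule joining_Image_eq_minimal[OF assms J H(1,3)])
  then show "disjoint_systems X T Y S"
    using joining_Times[OF assms] unfolding disjoint_systems_def by blast
next
  assume H: "tds_transitive X T \<and> dense_small_periodic_sets X T \<and> totally_minimal Y S"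
  have "J = X \<times> Y" if J: "joining X T Y S J" for J
  proof (rule joining_eq_Times[OF assms J])
    show "dense_small_periodic_sets X T"
      using H by blast
    fix Z k assume Z: "compact Z" "Z \<noteq> {}" "Z \<subseteq> X" "(k::nat) \<ge> 1" "(T ^^ k) ` Z \<subseteq> Z"
    show "Y \<subseteq> J `` Z"
    \<comment> \<open>By total minimality \<open>Y\<close> itself is the
      \<open>S ^^ k\<close>-minimal set here; the image of \<open>Z\<close> meets it since
      \<open>J\<close> projects onto \<open>X\<close>.\<close>
    proof (rule minimal_subset_Image)
      show "tds Y (S ^^ k)" "tds_minimal Y (S ^^ k)"
        using H Z(4) tds_funpow[OF assms(2)] by (auto simp: totally_minimal_def)
      show "compact J" "map_prod (T ^^ k) (S ^^ k) ` J \<subseteq> J"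
        using joining_compact[OF assms J] joining_funpow_subset[OF J] by auto
      have "fst ` J = X" "snd ` J = Y"
        using J unfolding joining_def by blast+
      moreover obtain z where "z \<in> Z" "z \<in> X"
        using Z(2,3) by blast
      ultimately obtain p where "p \<in> J" "fst p = z" "snd p \<in> Y"
        by blast
      then have "snd p \<in> J `` Z \<inter> Y"
        using \<open>z \<in> Z\<close> by (cases p) auto
      then show "J `` Z \<inter> Y \<noteq> {}"
        by blast
    qed (use Z in auto)
  qed
  then show "disjoint_systems X T Y S"
    using joining_Times[OF assms] unfolding disjoint_systems_def by blast
qed

end
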